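(* Let $g$ be the impulse response of a finite-dimensional causal discrete-time LTI system such that $g\in\ell_1$, $g(0)>0$, the support of $g$ is $\{t_1+i: i\in\mathbb{Z}_{\ge 0}\}$ for some $t_1\in\mathbb{Z}_{\ge 0}$ (hence $t_1=0$), and $g$ is strictly monotonically decreasing on its support. Then there do not exist a period $P\in\mathbb{Z}_{>0}$ and a $P$-periodic sequence $u:\mathbb{Z}\to\mathbb{R}$ with $S_c^-(\Delta_c u^P)=2$ and $S_c^+(u^P)=2$ such that $$u(t)=-\mathcal{C}_g(\mathrm{sign}(u))(t)\quad\text{for all } t\in\mathbb{Z}.$$
   Context: Finite-dimensional causal LTI system: its impulse response $g:\mathbb{Z}\to\mathbb{R}$ satisfies $g(t)=0$ for $t<0$ and $G(z)=\sum_{t\ge 0}g(t)z^{-t}$ is rational. $g\in\ell_1$ means $\sum_{t}|g(t)|<\infty$. The convolution operator is $\mathcal{C}_g(w)(t):=\sum_{\tau\in\mathbb{Z}}g(t-\tau)w(\tau)$ for bounded $w$. For a $P$-periodic sequence $x$, $x^P:=[x(0),\dots,x(P-1)]^\top$. $\mathrm{sign}(t)=1,0,-1$ for $t>0$, $t=0$, $t<0$, applied entrywise to sequences. Cyclic forward difference: for $v\in\mathbb{R}^n$, $\Delta_c v:=[v_2-v_1,\,v_3-v_2,\dots,v_1-v_n]^\top$. Variation: $S^-(v)$ is the number of sign changes between consecutive entries of the vector obtained from $v$ by deleting all zeros, with $S^-(0)=-1$. Cyclic variation: $S_c^-(v):=\max_{1\le i\le n}S^-([v_i,\dots,v_n,v_1,\dots,v_i])$.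 $S_c^+(v)$ is the maximum of $S_c^-(\bar v)$ over all $\bar v\in\mathbb{R}^n$ obtained from $v$ by replacing its zero entries by arbitrary real numbers. *)

theory Defs
  imports "HOL-Analysis.Analysis" "HOL-Computational_Algebra.Polynomial"
begin

text \<open>
  Rationality of the transfer function \<open>G(z) = \<Sum>t\<ge>0. g(t) z\<^sup>-\<^sup>t\<close> is equality with a
  quotient of polynomials for all \<open>z\<close> of sufficiently large modulus; this leaves out the
  finitely many zeros of the denominator.
\<close>

definition finite_dim_causal :: "(int \<Rightarrow> real) \<Rightarrow> bool" where
  "finite_dim_causal g \<longleftrightarrow>
     (\<forall>t<0. g t = 0) \<and>
     (\<exists>p q :: real poly. q \<noteq> 0 \<and>
        (\<forall>\<^sub>F z :: complex in at_infinity.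
           (\<lambda>t::nat. complex_of_real (g (int t)) * z powi (- int t)) sums
             (poly (map_poly complex_of_real p) z / poly (map_poly complex_of_real q) z)))"

text \<open>
  An unconditional sum over the integers; it is \<open>0\<close> by convention when it does not converge, which
  cannot happen for summable \<open>g\<close> and bounded \<open>w\<close>.
\<close>

definition convolution :: "(int \<Rightarrow> real) \<Rightarrow> (int \<Rightarrow> real) \<Rightarrow> int \<Rightarrow> real" where
  "convolution g w t = (\<Sum>\<^sub>\<infinity>\<tau>\<in>UNIV. g (t - \<tau>) * w \<tau>)"

definition periodic :: "nat \<Rightarrow> (int \<Rightarrow> real) \<Rightarrow> bool" where
  "periodic P x \<longleftrightarrow> (\<forall>t. x (t + int P) = x t)"

text \<open>A vector in \<open>\<real>\<^sup>n\<close> is a list of length \<open>n\<close>, indexed from \<open>0\<close>.\<close>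

definition one_period :: "nat \<Rightarrow> (int \<Rightarrow> real) \<Rightarrow> real list" where
  "one_period P x = map (\<lambda>i. x (int i)) [0..<P]"

definition cyclic_diff :: "real list \<Rightarrow> real list" where
  "cyclic_diff v = map (\<lambda>i. v ! (Suc i mod length v) - v ! i) [0..<length v]"

definition variation :: "real list \<Rightarrow> int" where
  "variation v =
     (let w = filter (\<lambda>x. x \<noteq> 0) v in
      if w = [] then -1
      else int (card {i. Suc i < length w \<and> sgn (w ! i) \<noteq> sgn (w ! Suc i)}))"

text \<open>The two maxima below are only meaningful for nonempty vectors.\<close>

definition cyclic_variation :: "real list \<Rightarrow> int" where
  "cyclic_variation v = Max ((\<lambda>i. variation (drop i v @ take (Suc i) v)) ` {..<length v})"

definition zero_fillings :: "real list \<Rightarrow> real list set" where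
  "zero_fillings v =
     {v'. length v' = length v \<and> (\<forall>i<length v. v ! i \<noteq> 0 \<longrightarrow> v' ! i = v ! i)}"

definition cyclic_variation_plus :: "real list \<Rightarrow> int" where
  "cyclic_variation_plus v = Max (cyclic_variation ` zero_fillings v)"

text \<open>
  The set of fillings is usually infinite, but its image under
  \<^const>\<open>cyclic_variation\<close> is finite, so the last maximum is attained.
\<close>

lemma variation_bounds: "variation v \<in> {-1..int (length v)}"
proof -
  define w where "w = filter (\<lambda>x. x \<noteq> 0) v"
  have "card {i. Suc i < length w \<and> sgn (w ! i) \<noteq> sgn (w ! Suc i)} \<le> card {..<length w}"
    by (rule card_mono) auto
  also have "\<dots> \<le> length v"
    by (simp add: w_def)
  finally show ?thesis
    by (auto simp: variation_def Let_def w_def)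
qed

lemma finite_cyclic_variation_fillings:
  assumes "v \<noteq> []"
  shows "finite (cyclic_variation ` zero_fillings v)"
proof (rule finite_subset)
  show "cyclic_variation ` zero_fillings v \<subseteq> {-1..int (Suc (length v))}"
  proof
    fix k assume "k \<in> cyclic_variation ` zero_fillings v"
    then obtain v' where v': "length v' = length v" "k = cyclic_variation v'"
      by (auto simp: zero_fillings_def)
    let ?A = "(\<lambda>i. variation (drop i v' @ take (Suc i) v')) ` {..<length v'}"
    have "?A \<noteq> {}"
      using assms v' by auto
    then have "k \<in> ?A"
      unfolding v'(2) cyclic_variation_def by (intro Max_in) auto
    then obtain i where "i < length v'" "k = variation (drop i v' @ take (Suc i) v')"
      by auto
    then show "k \<in> {-1..int (Suc (length v))}"
      using variation_bounds[of "drop i v' @ take (Suc i) v'"] v'(1) by auto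
  qed
qed simp

end

theory Submission imports Defs begin

text \<open>
  The feedback equation \<open>u = - C\<^sub>g (sign u)\<close> has no solution except \<open>u = 0\<close>, and for
  \<open>u = 0\<close> the cyclic variation of the differences is \<open>-1\<close>.

  Let \<open>s = sign u\<close>. Since \<open>g\<close> decreases to \<open>0\<close>, it is nonnegative, and adding the constant
  \<open>\<Sum>k. g k\<close> to the equation gives \<open>(\<Sum>k. g k) + u t = (\<Sum>k. g k * (1 - s (t - k)))\<close>, where all terms
  are nonnegative. If \<open>u t > 0\<close>, the term \<open>k = 0\<close> vanishes. Lowering the index of \<open>g\<close> by one in the
  remaining terms cannot decrease them, and produces exactly the corresponding series at time
  \<open>t - 1\<close>; hence \<open>u (t - 1) \<ge> u t > 0\<close>. This is lemma \<open>feedback_positive_imp_past_ge\<close>. So a positive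
  value propagates to the whole past; but then \<open>s = 1\<close> on the whole past and the equation reads
  \<open>u t = - (\<Sum>k. g k) \<le> 0\<close>, a contradiction. Since the equation is odd in \<open>u\<close>, negative values are
  excluded in the same way.
\<close>

lemma convolution_causal_sums:
  fixes g w :: "int \<Rightarrow> real"
  assumes causal: "\<And>t. t < 0 \<Longrightarrow> g t = 0"
    and summable: "(\<lambda>t. \<bar>g t\<bar>) summable_on UNIV"
    and bounded: "\<And>t. \<bar>w t\<bar> \<le> B"
  shows "(\<lambda>k. g (int k) * w (t - int k)) sums convolution g w t"
proof -
  let ?F = "\<lambda>i. g i * w (t - i)"
  have "(\<lambda>i. B * \<bar>g i\<bar>) summable_on UNIV"
    by (intro summable_on_cmult_right summable)
  then have "(\<lambda>i. norm (?F i)) summable_on UNIV"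
  proof (rule summable_on_comparison_test)
    fix i
    show "norm (?F i) \<le> B * \<bar>g i\<bar>"
      using mult_right_mono[OF bounded[of "t - i"], of "\<bar>g i\<bar>"] by (simp add: abs_mult mult.commute)
  qed auto
  then have "?F summable_on UNIV"
    by (rule abs_summable_summable)
  then have "(?F has_sum infsum ?F UNIV) UNIV"
    by (rule has_sum_infsum)
  moreover have "infsum ?F UNIV = convolution g w t"
    unfolding convolution_def
    by (rule infsum_reindex_bij_witness[where i = "\<lambda>\<tau>. t - \<tau>" and j = "\<lambda>i. t - i"]) auto
  moreover have "(?F has_sum x) UNIV \<longleftrightarrow> (?F has_sum x) (range int)" for x
  proof (rule has_sum_cong_neutral)
    fix i assume "i \<in> UNIV - range int"
    then have "i < 0"
      by (metis DiffE not_le rangeI zero_le_imp_eq_int)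
    then show "?F i = 0"
      by (simp add: causal)
  qed auto
  moreover have "(?F has_sum x) (range int) \<longleftrightarrow> ((?F \<circ> int) has_sum x) UNIV" for x
    by (rule has_sum_reindex) simp
  ultimately have "((?F \<circ> int) has_sum convolution g w t) UNIV"
    by simp
  then show ?thesis
    by (auto dest: has_sum_imp_sums simp: o_def)
qed

text \<open>
  At a positive value of \<open>u\<close>, the deficits \<open>1 - sign u\<close> of the past inputs are weighted by
  \<open>g 1, g 2, \<dots>\<close>, while one step earlier the same deficits are weighted by the larger numbers
  \<open>g 0, g 1, \<dots>\<close>.
\<close>

lemma feedback_positive_imp_past_ge:
  fixes g u :: "int \<Rightarrow> real"
  assumes causal: "\<And>t. t < 0 \<Longrightarrow> g t = 0"
    and summable: "(\<lambda>t. \<bar>g t\<bar>) summable_on UNIV"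
    and decreasing: "decseq (\<lambda>k. g (int k))"
    and feedback: "\<And>t. u t = - convolution g (\<lambda>\<tau>. sgn (u \<tau>)) t"
    and pos: "u t > 0"
  shows "u t \<le> u (t - 1)"
proof -
  let ?s = "\<lambda>t. sgn (u t)"
  let ?S = "\<Sum>k. g (int k)"
  have sums_g: "(\<lambda>k. g (int k)) sums ?S"
    using convolution_causal_sums[where w = "\<lambda>_. 1" and B = 1, OF causal summable]
    by (auto simp: sums_iff)
  have deficit: "(\<lambda>k. g (int k) * (1 - ?s (r - int k))) sums (?S + u r)" for r
  proof -
    have "(\<lambda>k. g (int k) * ?s (r - int k)) sums convolution g ?s r"
      by (rule convolution_causal_sums[where B = 1, OF causal summable]) (auto simp: sgn_if)
    from sums_diff[OF sums_g this] show ?thesis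
      by (subst feedback) (simp add: algebra_simps)
  qed
  have "(\<lambda>k. g (int (Suc k)) * (1 - ?s (t - int (Suc k)))) sums (?S + u t)"
    using deficit[of t] pos by (subst sums_Suc_iff) simp
  moreover have "(\<lambda>k. g (int k) * (1 - ?s (t - int (Suc k)))) sums (?S + u (t - 1))"
    using deficit[of "t - 1"] by (simp add: algebra_simps)
  moreover have "g (int (Suc k)) * (1 - ?s (t - int (Suc k)))
      \<le> g (int k) * (1 - ?s (t - int (Suc k)))" for k
    by (intro mult_right_mono decseqD[OF decreasing]) (auto simp: sgn_if)
  ultimately have "?S + u t \<le> ?S + u (t - 1)"
    by (rule sums_le[rotated 1])
  then show ?thesis
    by simp
qed

lemma feedback_nonpositive:
  fixes g u :: "int \<Rightarrow> real"
  assumes causal: "\<And>t. t < 0 \<Longrightarrow> g t = 0"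
    and summable: "(\<lambda>t. \<bar>g t\<bar>) summable_on UNIV"
    and decreasing: "decseq (\<lambda>k. g (int k))"
    and feedback: "\<And>t. u t = - convolution g (\<lambda>\<tau>. sgn (u \<tau>)) t"
  shows "u t \<le> 0"
proof (rule ccontr)
  assume "\<not> u t \<le> 0"
  then have past: "u (t - int k) > 0" for k
  proof (induction k)
    case (Suc k)
    then show ?case
      using feedback_positive_imp_past_ge[where t = "t - int k", OF causal summable decreasing feedback]
      by (simp add: algebra_simps)
  qed simp
  have "(\<lambda>k. g (int k) * sgn (u (t - int k))) sums convolution g (\<lambda>\<tau>. sgn (u \<tau>)) t"
    by (rule convolution_causal_sums[where B = 1, OF causal summable]) (auto simp: sgn_if)
  then have sums_g: "(\<lambda>k. g (int k)) sums convolution g (\<lambda>\<tau>. sgn (u \<tau>)) t"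
    using past by simp
  then have "(\<lambda>k. g (int k)) \<longlonglongrightarrow> 0"
    by (intro summable_LIMSEQ_zero sums_summable)
  then have "g (int k) \<ge> 0" for k
    by (rule decseq_ge[OF decreasing])
  from this sums_zero sums_g have "convolution g (\<lambda>\<tau>. sgn (u \<tau>)) t \<ge> 0"
    by (rule sums_le)
  with feedback[of t] past[of 0] show False
    by simp
qed

lemma feedback_zero:
  fixes g u :: "int \<Rightarrow> real"
  assumes causal: "\<And>t. t < 0 \<Longrightarrow> g t = 0"
    and summable: "(\<lambda>t. \<bar>g t\<bar>) summable_on UNIV"
    and decreasing: "decseq (\<lambda>k. g (int k))"
    and feedback: "\<And>t. u t = - convolution g (\<lambda>\<tau>. sgn (u \<tau>)) t"
  shows "u t = 0"
proof (rule antisym)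
  show "u t \<le> 0"
    by (rule feedback_nonpositive[OF causal summable decreasing feedback])
  have "- u r = - convolution g (\<lambda>\<tau>. sgn (- u \<tau>)) r" for r
    by (subst feedback) (simp add: convolution_def sgn_minus infsum_uminus)
  from feedback_nonpositive[where u = "\<lambda>t. - u t", OF causal summable decreasing this]
  show "0 \<le> u t"
    by simp
qed

lemma cyclic_variation_zero_vector:
  assumes "v \<noteq> []" and "\<And>x. x \<in> set v \<Longrightarrow> x = 0"
  shows "cyclic_variation v = -1"
proof -
  have "variation (drop i v @ take (Suc i) v) = -1" for i
    using assms(2) by (auto simp: variation_def Let_def filter_empty_conv dest!: in_set_dropD in_set_takeD)
  moreover have "{..<length v} \<noteq> {}"
    using assms(1) by auto
  ultimately show ?thesis
    by (simp add: cyclic_variation_def)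
qed

theorem theorem2:
  fixes g :: "int \<Rightarrow> real" and t1 :: nat
  assumes "finite_dim_causal g"
    and "(\<lambda>t. \<bar>g t\<bar>) summable_on UNIV"
    and "g 0 > 0"
    and "{t. g t \<noteq> 0} = {int t1 + int i | i. True}"
    and "strict_antimono_on {t. g t \<noteq> 0} g"
  shows "\<not> (\<exists>(P::nat) (u :: int \<Rightarrow> real).
            P > 0 \<and> periodic P u \<and>
            cyclic_variation (cyclic_diff (one_period P u)) = 2 \<and>
            cyclic_variation_plus (one_period P u) = 2 \<and>
            (\<forall>t. u t = - convolution g (\<lambda>\<tau>. sgn (u \<tau>)) t))"
proof (intro notI, elim exE conjE)
  fix P :: nat and u :: "int \<Rightarrow> real"
  assume P: "P > 0"
    and var: "cyclic_variation (cyclic_diff (one_period P u)) = 2"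
    and feedback: "\<forall>t. u t = - convolution g (\<lambda>\<tau>. sgn (u \<tau>)) t"
  have causal: "g t = 0" if "t < 0" for t
    using assms(1) that by (simp add: finite_dim_causal_def)
  have "0 \<in> {int t1 + int i | i. True}"
    unfolding assms(4)[symmetric] using assms(3) by simp
  then have "t1 = 0"
    by auto
  then have support: "{t. g t \<noteq> 0} = range int"
    using assms(4) by auto
  have decreasing: "decseq (\<lambda>k. g (int k))"
    using assms(5) unfolding support
    by (auto simp: monotone_on_def decseq_def le_less)
  have zero: "u t = 0" for t
    by (rule feedback_zero[OF causal assms(2) decreasing feedback[rule_format]])
  have "cyclic_variation (cyclic_diff (one_period P u)) = -1"
  proof (rule cyclic_variation_zero_vector)
    show "cyclic_diff (one_period P u) \<noteq> []"
      using P by (simp add: cyclic_diff_def one_period_def)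
    show "x = 0" if "x \<in> set (cyclic_diff (one_period P u))" for x
      using that by (auto simp: cyclic_diff_def one_period_def zero)
  qed
  with var show False
    by simp
qed

end
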